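(* Let $X,Y$ be LCTV spaces, $\phi\colon X\times Y\to\overline{\mathbb R}$ an int-nearly convex function, $F\colon X\rightrightarrows Y$ an int-nearly convex set-valued mapping, and let $\mu(x):=\inf\{\phi(x,y)\mid y\in F(x)\}$ for $x\in X$. Assume that $\mu$ is proper, that $$\operatorname{int}(\operatorname{epi}\phi)\cap\operatorname{int}\big((\operatorname{gph}F)\times[0,\infty)\big)\neq\emptyset,$$ and that the conjugate function $\mu^*$ is proper. Then for every $\epsilon\ge0$ and every $x_0^*\in X^*$ with $\mu^*(x_0^* )\in\mathbb R$, $$\partial_\epsilon\mu^*(x_0^* )=\bigcap_{\eta>0}\operatorname{cl}\Big\{x\in X\;\Big|\;\exists\,y\in F(x)\text{ such that }x_0^*\in\bigcup_{\substack{\epsilon_1+\epsilon_2=\epsilon+\eta\\ \epsilon_1,\epsilon_2\ge0}}\big\{x_1^*+D^*_{\epsilon_2}F(x,y)(y_1^* )\;\big|\;(x_1^*,y_1^* )\in\partial_{\epsilon_1}\phi(x,y)\big\}\Big\},$$ where the inner set in braces denotes the union of the sets $x_1^*+D^*_{\epsilon_2}F(x,y)(y_1^* )$ over all $(x_1^*,y_1^* )\in\partial_{\epsilon_1}\phi(x,y)$ and $\operatorname{cl}$ is closure in $X$.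
   Context: LCTV space means real locally convex Hausdorff topological vector space; $X^*$ is the topological dual, $\langle x^*,x\rangle=x^*(x)$, and $(X\times Y)^*$ is identified with $X^*\times Y^*$. $\overline{\mathbb R}=\mathbb R\cup\{-\infty\}\cup\{\infty\}$ and $\inf\emptyset=\infty$. A function is proper if it is not identically $\infty$ and never takes the value $-\infty$. $\operatorname{epi}f=\{(x,\lambda)\in X\times\mathbb R\mid f(x)\le\lambda\}$, $\operatorname{gph}F=\{(x,y)\mid y\in F(x)\}$. A set $\Omega$ is int-nearly convex if there is a convex set $C$ with $\operatorname{int}C\ne\emptyset$ and $C\subset\Omega\subset\overline C$; a function (resp. set-valued mapping) is int-nearly convex if its epigraph (resp. graph) is. In the displayed condition $(\operatorname{gph}F)\times[0,\infty)\subset X\times Y\times\mathbb R$. The Fenchel conjugate is $\mu^*(x^* )=\sup\{\langle x^*,x\rangle-\mu(x)\mid x\in X\}$. For $\epsilon\ge0$, $\partial_\epsilon f(x_0)=\{x^*\in X^*\mid\langle x^*,x-x_0\rangle\le f(x)-f(x_0)+\epsilon\ \forall x\in X\}$ if $f(x_0)\in\mathbb R$ and $\emptyset$ otherwise. For the conjugate, the $\epsilon$-subdifferential is taken as a subset of $X$: $\partial_\epsilon\mu^*(x_0^* )=\{x\in X\mid\langle x^*-x_0^*,x\rangle\le\mu^*(x^* )-\mu^*(x_0^* )+\epsilon\ \forall x^*\in X^*\}$. The $\epsilon$-normal cone to $\Omega$ at $x_0\in\Omega$ is $N_\epsilon(x_0;\Omega)=\{x^*\mid\langle x^*,x-x_0\rangle\le\epsilon\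 \forall x\in\Omega\}$; the $\epsilon$-coderivative of $F$ at $(x_0,y_0)\in\operatorname{gph}F$ is $D^*_\epsilon F(x_0,y_0)(y^* )=\{x^*\in X^*\mid(x^*,-y^* )\in N_\epsilon((x_0,y_0);\operatorname{gph}F)\}$, $y^*\in Y^*$. *)

theory Defs
  imports "HOL-Analysis.Analysis"
begin

text \<open>Continuity of addition is an axiom here rather than inherited from
  \<open>topological_ab_group_add\<close>: the library makes products instances of that class only for
  normed factors, which would rule out the instance for products of \<open>lctvs\<close> spaces.\<close>

class lctvs = real_vector + t2_space +
  assumes lctvs_tendsto_add:
    "filterlim (\<lambda>p. fst p + snd p) (nhds (a + b)) (nhds a \<times>\<^sub>F nhds b)"
  and lctvs_tendsto_scaleR:
    "filterlim (\<lambda>p. fst p *\<^sub>R snd p) (nhds (c *\<^sub>R a)) (nhds (c::real) \<times>\<^sub>F nhds a)"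
  and locally_convex_zero_unfolded:
    "open U \<Longrightarrow> 0 \<in> U \<Longrightarrow> \<exists>V. open V \<and> 0 \<in> V \<and>
      (\<forall>x\<in>V. \<forall>y\<in>V. \<forall>u\<ge>0. \<forall>v\<ge>0. u + v = (1::real) \<longrightarrow> u *\<^sub>R x + v *\<^sub>R y \<in> V) \<and> V \<subseteq> U"

text \<open>The class axiom spells out \<open>convex V\<close> because that constant, being sort-constrained to
  \<open>real_vector\<close>, cannot occur in a class specification.\<close>

lemma locally_convex_zero:
  fixes U :: "'a::lctvs set"
  shows "open U \<Longrightarrow> 0 \<in> U \<Longrightarrow> \<exists>V. open V \<and> 0 \<in> V \<and> convex V \<and> V \<subseteq> U"
  unfolding convex_def by (rule locally_convex_zero_unfolded)

instance real_normed_vector \<subseteq> lctvs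
proof
  fix a b :: 'a
  show "filterlim (\<lambda>p. fst p + snd p) (nhds (a + b)) (nhds a \<times>\<^sub>F nhds b)"
    by (rule tendsto_add_Pair)
next
  fix c :: real and a :: 'a
  have "((\<lambda>p. fst p *\<^sub>R snd p) \<longlongrightarrow> c *\<^sub>R a) (nhds (c, a))"
    using tendsto_scaleR[OF tendsto_fst[OF filterlim_ident[of "nhds (c, a)"]]
        tendsto_snd[OF filterlim_ident[of "nhds (c, a)"]]] by simp
  then show "filterlim (\<lambda>p. fst p *\<^sub>R snd p) (nhds (c *\<^sub>R a)) (nhds c \<times>\<^sub>F nhds a)"
    by (simp add: nhds_prod)
next
  fix U :: "'a set"
  assume "open U" "0 \<in> U"
  then obtain e where "e > 0" "ball 0 e \<subseteq> U"
    using open_contains_ball by blast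
  then have "open (ball (0::'a) e) \<and> 0 \<in> ball (0::'a) e \<and> convex (ball (0::'a) e) \<and> ball 0 e \<subseteq> U"
    by simp
  then show "\<exists>V. open V \<and> 0 \<in> V \<and>
      (\<forall>x\<in>V. \<forall>y\<in>V. \<forall>u\<ge>0. \<forall>v\<ge>0. u + v = (1::real) \<longrightarrow> u *\<^sub>R x + v *\<^sub>R y \<in> V) \<and> V \<subseteq> U"
    unfolding convex_def by (rule exI)
qed

instance prod :: (lctvs, lctvs) lctvs
proof
  fix a b :: "'a \<times> 'b"
  have 1: "((\<lambda>p. fst p) \<longlongrightarrow> a) (nhds (a, b))"
    and 2: "((\<lambda>p. snd p) \<longlongrightarrow> b) (nhds (a, b))"
    using tendsto_fst[OF filterlim_ident[of "nhds (a, b)"]]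
      tendsto_snd[OF filterlim_ident[of "nhds (a, b)"]] by auto
  have 3: "filterlim (\<lambda>p. (fst (fst p), fst (snd p))) (nhds (fst a) \<times>\<^sub>F nhds (fst b)) (nhds (a, b))"
    unfolding nhds_prod[symmetric] by (intro tendsto_Pair tendsto_fst[OF 1] tendsto_fst[OF 2])
  have 4: "filterlim (\<lambda>p. (snd (fst p), snd (snd p))) (nhds (snd a) \<times>\<^sub>F nhds (snd b)) (nhds (a, b))"
    unfolding nhds_prod[symmetric] by (intro tendsto_Pair tendsto_snd[OF 1] tendsto_snd[OF 2])
  have "((\<lambda>p. (fst (fst p) + fst (snd p), snd (fst p) + snd (snd p))) \<longlongrightarrow>
      (fst a + fst b, snd a + snd b)) (nhds (a, b))"
    using filterlim_compose[OF lctvs_tendsto_add 3] filterlim_compose[OF lctvs_tendsto_add 4]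
    by (intro tendsto_Pair) simp_all
  then show "filterlim (\<lambda>p. fst p + snd p) (nhds (a + b)) (nhds a \<times>\<^sub>F nhds b)"
    by (simp add: nhds_prod plus_prod_def)
next
  fix c :: real and a :: "'a \<times> 'b"
  have 1: "((\<lambda>p. fst p) \<longlongrightarrow> c) (nhds (c, a))"
    and 2: "((\<lambda>p. snd p) \<longlongrightarrow> a) (nhds (c, a))"
    using tendsto_fst[OF filterlim_ident[of "nhds (c, a)"]]
      tendsto_snd[OF filterlim_ident[of "nhds (c, a)"]] by auto
  have 3: "filterlim (\<lambda>p. (fst p, fst (snd p))) (nhds c \<times>\<^sub>F nhds (fst a)) (nhds (c, a))"
    unfolding nhds_prod[symmetric] by (intro tendsto_Pair 1 tendsto_fst[OF 2])
  have 4: "filterlim (\<lambda>p. (fst p, snd (snd p))) (nhds c \<times>\<^sub>F nhds (snd a)) (nhds (c, a))"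
    unfolding nhds_prod[symmetric] by (intro tendsto_Pair 1 tendsto_snd[OF 2])
  have "((\<lambda>p. (fst p *\<^sub>R fst (snd p), fst p *\<^sub>R snd (snd p))) \<longlongrightarrow>
      (c *\<^sub>R fst a, c *\<^sub>R snd a)) (nhds (c, a))"
    using filterlim_compose[OF lctvs_tendsto_scaleR 3] filterlim_compose[OF lctvs_tendsto_scaleR 4]
    by (intro tendsto_Pair) simp_all
  then show "filterlim (\<lambda>p. fst p *\<^sub>R snd p) (nhds (c *\<^sub>R a)) (nhds c \<times>\<^sub>F nhds a)"
    by (simp add: nhds_prod scaleR_prod_def)
next
  fix U :: "('a \<times> 'b) set"
  assume "open U" "0 \<in> U"
  then obtain A B where "open A" "open B" and 0: "0 \<in> A \<times> B" and "A \<times> B \<subseteq> U"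
    by (rule open_prod_elim)
  moreover from 0 have "(0::'a) \<in> A" "(0::'b) \<in> B"
    by (simp_all add: zero_prod_def)
  ultimately have AB: "open A" "open B" "0 \<in> A" "0 \<in> B" "A \<times> B \<subseteq> U"
    by simp_all
  obtain V where V: "open V" "0 \<in> V" "convex V" "V \<subseteq> A"
    using locally_convex_zero[OF AB(1,3)] by blast
  obtain W where W: "open W" "0 \<in> W" "convex W" "W \<subseteq> B"
    using locally_convex_zero[OF AB(2,4)] by blast
  have "open (V \<times> W) \<and> 0 \<in> V \<times> W \<and> convex (V \<times> W) \<and> V \<times> W \<subseteq> U"
    using V W AB by (auto simp: open_Times convex_Times zero_prod_def)
  then show "\<exists>V. open V \<and> 0 \<in> V \<and>
      (\<forall>x\<in>V. \<forall>y\<in>V. \<forall>u\<ge>0. \<forall>v\<ge>0. u + v = (1::real) \<longrightarrow> u *\<^sub>R x + v *\<^sub>R y \<in> V) \<and> V \<subseteq> U"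
    unfolding convex_def by (rule exI)
qed

definition dual_space :: "('a::lctvs \<Rightarrow> real) set" where
  "dual_space = {f. linear f \<and> continuous_on UNIV f}"

text \<open>The identification of \<open>X\<^sup>* \<times> Y\<^sup>*\<close> with the dual of \<open>X \<times> Y\<close>.\<close>

definition pair_functional :: "('a \<Rightarrow> real) \<Rightarrow> ('b \<Rightarrow> real) \<Rightarrow> 'a \<times> 'b \<Rightarrow> real" where
  "pair_functional xs ys = (\<lambda>(x, y). xs x + ys y)"

definition int_nearly_convex :: "'a::lctvs set \<Rightarrow> bool" where
  "int_nearly_convex \<Omega> \<longleftrightarrow>
    (\<exists>C. convex C \<and> interior C \<noteq> {} \<and> C \<subseteq> \<Omega> \<and> \<Omega> \<subseteq> closure C)"

definition epi :: "('a \<Rightarrow> ereal) \<Rightarrow> ('a \<times> real) set" where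
  "epi f = {(x, l). f x \<le> ereal l}"

definition gph :: "('a \<Rightarrow> 'b set) \<Rightarrow> ('a \<times> 'b) set" where
  "gph F = {(x, y). y \<in> F x}"

definition int_nearly_convex_fun :: "('a::lctvs \<Rightarrow> ereal) \<Rightarrow> bool" where
  "int_nearly_convex_fun f \<longleftrightarrow> int_nearly_convex (epi f)"

definition int_nearly_convex_map :: "('a::lctvs \<Rightarrow> 'b::lctvs set) \<Rightarrow> bool" where
  "int_nearly_convex_map F \<longleftrightarrow> int_nearly_convex (gph F)"

text \<open>The domain \<open>S\<close> is explicit because conjugates are only meaningful on \<open>dual_space\<close>,
  which is a proper subset of its ambient function type.\<close>

definition proper_on :: "'a set \<Rightarrow> ('a \<Rightarrow> ereal) \<Rightarrow> bool" where
  "proper_on S f \<longleftrightarrow> (\<exists>x\<in>S. f x \<noteq> \<infinity>) \<and> (\<forall>x\<in>S. f x \<noteq> -\<infinity>)"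

definition conjugate :: "('a \<Rightarrow> ereal) \<Rightarrow> ('a \<Rightarrow> real) \<Rightarrow> ereal" where
  "conjugate f xs = (SUP x. ereal (xs x) - f x)"

definition optimal_value :: "('a \<times> 'b \<Rightarrow> ereal) \<Rightarrow> ('a \<Rightarrow> 'b set) \<Rightarrow> 'a \<Rightarrow> ereal" where
  "optimal_value \<phi> F x = (INF y\<in>F x. \<phi> (x, y))"

definition eps_subdifferential ::
  "real \<Rightarrow> ('a::lctvs \<Rightarrow> ereal) \<Rightarrow> 'a \<Rightarrow> ('a \<Rightarrow> real) set" where
  "eps_subdifferential \<epsilon> f x0 =
    (if \<bar>f x0\<bar> \<noteq> \<infinity>
     then {xs \<in> dual_space. \<forall>x. ereal (xs (x - x0)) \<le> f x - f x0 + ereal \<epsilon>}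
     else {})"

definition eps_subdifferential_pairs ::
  "real \<Rightarrow> ('a::lctvs \<times> 'b::lctvs \<Rightarrow> ereal) \<Rightarrow> 'a \<times> 'b \<Rightarrow> (('a \<Rightarrow> real) \<times> ('b \<Rightarrow> real)) set" where
  "eps_subdifferential_pairs \<epsilon> \<phi> z =
    {(xs, ys) \<in> dual_space \<times> dual_space.
      pair_functional xs ys \<in> eps_subdifferential \<epsilon> \<phi> z}"

text \<open>For functions on the dual space, the subdifferential is taken in the primal space.\<close>

definition eps_subdifferential_dual ::
  "real \<Rightarrow> (('a::lctvs \<Rightarrow> real) \<Rightarrow> ereal) \<Rightarrow> ('a \<Rightarrow> real) \<Rightarrow> 'a set" where
  "eps_subdifferential_dual \<epsilon> g x0s =
    (if \<bar>g x0s\<bar> \<noteq> \<infinity>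
     then {x. \<forall>xs\<in>dual_space. ereal (xs x - x0s x) \<le> g xs - g x0s + ereal \<epsilon>}
     else {})"

definition eps_normal_cone :: "real \<Rightarrow> 'a::lctvs \<Rightarrow> 'a set \<Rightarrow> ('a \<Rightarrow> real) set" where
  "eps_normal_cone \<epsilon> x0 \<Omega> = {xs \<in> dual_space. \<forall>x\<in>\<Omega>. xs (x - x0) \<le> \<epsilon>}"

definition eps_coderivative ::
  "real \<Rightarrow> ('a::lctvs \<Rightarrow> 'b::lctvs set) \<Rightarrow> 'a \<times> 'b \<Rightarrow> ('b \<Rightarrow> real) \<Rightarrow> ('a \<Rightarrow> real) set" where
  "eps_coderivative \<epsilon> F z ys =
    {xs \<in> dual_space. pair_functional xs (\<lambda>y. - ys y) \<in> eps_normal_cone \<epsilon> z (gph F)}"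

end

theory Submission
  imports Defs
begin

text \<open>
  Both sides describe the points at which the Fenchel--Young inequality
  \<open>\<langle>x0s, x\<rangle> \<le> \<mu> x + \<mu>\<^sup>* x0s\<close> fails to be an equality by at most \<open>\<epsilon>\<close>, the left side after
  closing up \<open>\<mu>\<close>, the right side at points where the infimum defining \<open>\<mu>\<close> is nearly attained.

  For \<open>y \<in> F x\<close>, the membership of \<open>x0s\<close> in the union on the right with \<open>\<epsilon>1 + \<epsilon>2 = E\<close> says
  exactly that \<open>\<phi> (x, y)\<close> is finite and \<open>\<mu>\<^sup>* x0s \<le> \<langle>x0s, x\<rangle> - \<phi> (x, y) + E\<close>
  (\<open>eps_chain_rule_iff\<close>). Adding the two subgradient inequalities gives one implication. The
  other is a sum rule for \<open>\<phi>\<close> and the indicator of \<open>gph F\<close> (\<open>eps_subdifferential_sum_rule\<close>):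
  the functional \<open>(u, v) \<mapsto> \<langle>x0s, u\<rangle>\<close> is an \<open>E\<close>-subgradient of this sum, and separating the
  interior of \<open>epi \<phi>\<close> from the set of points over \<open>gph F\<close> below the affine minorant splits it.
  The interior hypothesis keeps the separating hyperplane from being vertical.

  With this description, a point of the right side satisfies
  \<open>\<langle>xs - x0s, x\<rangle> \<le> \<mu>\<^sup>* xs - \<mu>\<^sup>* x0s + \<epsilon> + \<eta>\<close> for every \<open>xs\<close> and every \<open>\<eta> > 0\<close>, because the
  inequality is closed in \<open>x\<close>. Conversely, let \<open>x\<close> be an \<open>\<epsilon>\<close>-subgradient of \<open>\<mu>\<^sup>*\<close> at \<open>x0s\<close>. If the
  point \<open>(x, \<langle>x0s, x\<rangle> - \<mu>\<^sup>* x0s + \<epsilon>)\<close> were not in the closure of the projection of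
  \<open>epi \<phi> \<inter> (gph F \<times> \<real>)\<close> to \<open>X \<times> \<real>\<close>, a hyperplane would separate it from that projection, and
  tilting \<open>x0s\<close> by the hyperplane would contradict the subgradient inequality
  (\<open>eps_subdifferential_dual_approx\<close>). Points of the projection near it lie in the sets whose
  closures are intersected.

  Int-near convexity enters only through two facts: the interior of such a set is convex, and a
  segment from any point of the set to an interior point is interior apart from its starting
  point. Hence a linear inequality on the interior holds on the whole set, and one can separate
  interiors. The separation theorem itself is derived for locally convex spaces from a
  Hahn--Banach theorem: a minimal sublinear functional is linear.
\<close>

section \<open>Topology of convex sets in locally convex spaces\<close>

lemma tendsto_add_lctvs:
  fixes a b :: "'a::lctvs"
  assumes "(f \<longlongrightarrow> a) G" "(g \<longlongrightarrow> b) G"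
  shows "((\<lambda>x. f x + g x) \<longlongrightarrow> a + b) G"
  using filterlim_compose[OF lctvs_tendsto_add filterlim_Pair[OF assms]] by simp

lemma tendsto_scaleR_lctvs:
  fixes a :: "'a::lctvs"
  assumes "(f \<longlongrightarrow> c) G" "(g \<longlongrightarrow> a) G"
  shows "((\<lambda>x. f x *\<^sub>R g x) \<longlongrightarrow> c *\<^sub>R a) G"
  using filterlim_compose[OF lctvs_tendsto_scaleR filterlim_Pair[OF assms]] by simp

lemma continuous_on_affine_lctvs:
  "continuous_on S (\<lambda>x::'a::lctvs. c *\<^sub>R x + a)"
  unfolding continuous_on_def
  by (intro ballI tendsto_add_lctvs tendsto_scaleR_lctvs tendsto_const tendsto_ident_at)

lemma open_affine_vimage:
  fixes S :: "'a::lctvs set"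
  shows "open S \<Longrightarrow> open {x. c *\<^sub>R x + a \<in> S}"
  using open_vimage[OF _ continuous_on_affine_lctvs] by (simp add: vimage_def)

lemma open_ray_vimage:
  fixes S :: "'a::lctvs set"
  assumes "open S" shows "open {t. a + t *\<^sub>R v \<in> S}"
proof -
  have "continuous_on UNIV (\<lambda>t. a + t *\<^sub>R v)"
    unfolding continuous_on_def
    by (intro ballI tendsto_add_lctvs tendsto_scaleR_lctvs tendsto_const tendsto_ident_at)
  from open_vimage[OF assms this] show ?thesis by (simp add: vimage_def)
qed

text \<open>Open sets are algebraically open: this is how the topology enters most arguments about
  linear functionals.\<close>

lemma open_ray_radius:
  fixes S :: "'a::lctvs set"
  assumes "open S" "a \<in> S"
  obtains r where "r > 0" "\<And>t. \<bar>t\<bar> < r \<Longrightarrow> a + t *\<^sub>R v \<in> S"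
proof -
  have "open {t. a + t *\<^sub>R v \<in> S}" "0 \<in> {t. a + t *\<^sub>R v \<in> S}"
    using open_ray_vimage assms by auto
  then obtain r where "r > 0" "ball 0 r \<subseteq> {t. a + t *\<^sub>R v \<in> S}"
    using open_contains_ball by blast
  then show thesis by (intro that[of r]) (auto simp: subset_iff)
qed

text \<open>Write the point \<open>z\<close> of the segment as \<open>(1 - t) c + t x'\<close> with \<open>c \<in> C\<close> close to \<open>y\<close>. Then \<open>x'\<close> is
  close to \<open>x\<close>, hence interior, and moving \<open>x'\<close> inside the interior moves \<open>z\<close> inside \<open>C\<close>.\<close>

lemma convex_interior_lctvs_segment:
  fixes C :: "'a::lctvs set"
  assumes "convex C" "x \<in> interior C" "y \<in> closure C" "0 < t" "t \<le> 1"
  shows "(1 - t) *\<^sub>R y + t *\<^sub>R x \<in> interior C"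
proof (cases "t = 1")
  case True then show ?thesis using assms by simp
next
  case False
  define z where "z = (1 - t) *\<^sub>R y + t *\<^sub>R x"
  define N where "N = {c. (- ((1 - t) / t)) *\<^sub>R c + (1 / t) *\<^sub>R z \<in> interior C}"
  have "open N" unfolding N_def by (rule open_affine_vimage) simp
  moreover have "y \<in> N"
  proof -
    have "(1 / t) *\<^sub>R z = ((1 - t) / t) *\<^sub>R y + x"
      using assms unfolding z_def by (simp add: scaleR_add_right)
    then show ?thesis using assms unfolding N_def by simp
  qed
  ultimately obtain c where c: "c \<in> C" "c \<in> N"
    using \<open>y \<in> closure C\<close> closure_iff_nhds_not_empty[of y C] by blast
  define W where "W = {w. (1 / t) *\<^sub>R w + (- ((1 - t) / t)) *\<^sub>R c \<in> interior C}"
  have "open W" unfolding W_def by (rule open_affine_vimage) simp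
  moreover have "z \<in> W" using c(2) unfolding W_def N_def by (simp add: algebra_simps)
  moreover have "W \<subseteq> C"
  proof
    fix w assume "w \<in> W"
    then have "(1 / t) *\<^sub>R w + (- ((1 - t) / t)) *\<^sub>R c \<in> C"
      unfolding W_def using interior_subset by blast
    from convexD[OF \<open>convex C\<close> c(1) this, of "1 - t" t]
    have "(1 - t) *\<^sub>R c + t *\<^sub>R ((1 / t) *\<^sub>R w + (- ((1 - t) / t)) *\<^sub>R c) \<in> C"
      using assms by simp
    moreover have "(1 - t) *\<^sub>R c + t *\<^sub>R ((1 / t) *\<^sub>R w + (- ((1 - t) / t)) *\<^sub>R c) = w"
      using assms by (simp add: scaleR_diff_right)
    ultimately show "w \<in> C" by simp
  qed
  ultimately show ?thesis unfolding z_def[symmetric] by (meson interior_maximal subsetD)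
qed

text \<open>A point \<open>z\<close> interior to the closure lies on a segment from an interior point \<open>x\<close> of \<open>C\<close> to a
  point of the closure slightly beyond \<open>z\<close>.\<close>

lemma interior_closure_convex_lctvs:
  fixes C :: "'a::lctvs set"
  assumes "convex C" "interior C \<noteq> {}"
  shows "interior (closure C) = interior C"
proof
  show "interior C \<subseteq> interior (closure C)" by (simp add: closure_subset interior_mono)
  show "interior (closure C) \<subseteq> interior C"
  proof
    fix z assume z: "z \<in> interior (closure C)"
    obtain x where x: "x \<in> interior C" using assms by blast
    obtain r where r: "r > 0" "\<And>t. \<bar>t\<bar> < r \<Longrightarrow> z + t *\<^sub>R (z - x) \<in> interior (closure C)"
      using open_ray_radius[OF open_interior z] by blast
    define s where "s = r / 2"
    have s: "s > 0" "z + s *\<^sub>R (z - x) \<in> closure C"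
      using r interior_subset unfolding s_def by fastforce+
    \<comment> \<open>the weight of \<open>x\<close> when \<open>z\<close> is a convex combination of \<open>x\<close> and \<open>z + s (z - x)\<close>\<close>
    define t where "t = s / (1 + s)"
    have t: "0 < t" "t \<le> 1" "(1 - t) * s = t" "1 - t + t = 1" using s by (auto simp: t_def field_simps)
    have "(1 - t) *\<^sub>R (z + s *\<^sub>R (z - x)) + t *\<^sub>R x = (1 - t) *\<^sub>R z + ((1 - t) * s) *\<^sub>R (z - x) + t *\<^sub>R x"
      by (simp add: algebra_simps)
    also have "\<dots> = z" unfolding t(3) by (simp add: algebra_simps)
    finally show "z \<in> interior C"
      using convex_interior_lctvs_segment[OF assms(1) x s(2) t(1,2)] by simp
  qed
qed

text \<open>The convex core \<open>C\<close> with \<open>C \<subseteq> S \<subseteq> closure C\<close> has the same interior as \<open>S\<close>, so the segment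
  property of convex sets passes to \<open>S\<close>.\<close>

lemma int_nearly_convex_segment:
  fixes S :: "'a::lctvs set"
  assumes "int_nearly_convex S" "x \<in> interior S" "y \<in> S" "0 < t" "t \<le> 1"
  shows "(1 - t) *\<^sub>R y + t *\<^sub>R x \<in> interior S"
proof -
  obtain C where C: "convex C" "interior C \<noteq> {}" "C \<subseteq> S" "S \<subseteq> closure C"
    using assms(1) unfolding int_nearly_convex_def by blast
  have "interior S \<subseteq> interior C"
    using interior_mono[OF C(4)] interior_closure_convex_lctvs[OF C(1,2)] by simp
  then have "(1 - t) *\<^sub>R y + t *\<^sub>R x \<in> interior C"
    using assms C by (intro convex_interior_lctvs_segment) auto
  then show ?thesis using interior_mono[OF C(3)] by blast
qed

lemma int_nearly_convex_convex_interior: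
  fixes S :: "'a::lctvs set"
  assumes "int_nearly_convex S"
  shows "convex (interior S)"
proof (rule convexI)
  fix x y and u v :: real
  assume *: "x \<in> interior S" "y \<in> interior S" "0 \<le> u" "0 \<le> v" "u + v = 1"
  show "u *\<^sub>R x + v *\<^sub>R y \<in> interior S"
  proof (cases "v = 0")
    case True then show ?thesis using * by simp
  next
    case False
    then have "(1 - v) *\<^sub>R x + v *\<^sub>R y \<in> interior S"
      using * interior_subset by (intro int_nearly_convex_segment[OF assms]) auto
    moreover have "1 - v = u" using * by simp
    ultimately show ?thesis by simp
  qed
qed

section \<open>Hahn--Banach theorem\<close>

text \<open>Homogeneity is required as an inequality and for positive factors only; equality and the
  value at \<open>0\<close> follow.\<close>

definition sublinear :: "('a::real_vector \<Rightarrow> real) \<Rightarrow> bool" where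
  "sublinear p \<longleftrightarrow>
    (\<forall>x y. p (x + y) \<le> p x + p y) \<and> (\<forall>c>0. \<forall>x. p (c *\<^sub>R x) \<le> c * p x)"

lemma sublinearD:
  assumes "sublinear p"
  shows "p (x + y) \<le> p x + p y" "c > 0 \<Longrightarrow> p (c *\<^sub>R x) \<le> c * p x"
    "p 0 = 0" "- p (- x) \<le> p x" "c \<ge> 0 \<Longrightarrow> p (c *\<^sub>R x) = c * p x"
proof -
  show sub: "p (x + y) \<le> p x + p y" for x y using assms unfolding sublinear_def by blast
  show hom: "p (c *\<^sub>R x) \<le> c * p x" if "c > 0" for c x
    using assms that unfolding sublinear_def by blast
  show zero: "p 0 = 0" using sub[of 0 0] hom[of "1/2" 0] by simp
  show "- p (- x) \<le> p x" using sub[of x "- x"] zero by simp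
  show "p (c *\<^sub>R x) = c * p x" if "c \<ge> 0"
  proof (cases "c = 0")
    case True then show ?thesis using zero by simp
  next
    case False
    then have c: "c > 0" using that by simp
    have "p x \<le> inverse c * p (c *\<^sub>R x)" using hom[of "inverse c" "c *\<^sub>R x"] c by simp
    then have "c * p x \<le> p (c *\<^sub>R x)" using c by (simp add: field_simps)
    with hom[OF c] show ?thesis by (simp add: antisym)
  qed
qed

text \<open>The largest sublinear functional below \<open>p\<close> whose value at \<open>- y\<close> is at most \<open>- p y\<close>. If it
  equals \<open>p\<close>, then \<open>p\<close> is additive in the direction \<open>y\<close>.\<close>

definition tilt :: "('a::real_vector \<Rightarrow> real) \<Rightarrow> 'a \<Rightarrow> 'a \<Rightarrow> real" where
  "tilt p y x = (INF t\<in>{0..}. p (x + t *\<^sub>R y) - t * p y)"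

lemma tilt_lower:
  assumes "sublinear p"
  shows "t \<ge> 0 \<Longrightarrow> tilt p y x \<le> p (x + t *\<^sub>R y) - t * p y"
proof -
  have lower: "- p (- x) \<le> p (x + t *\<^sub>R y) - t * p y" if "t \<ge> 0" for t
    using sublinearD(1)[OF assms, of "x + t *\<^sub>R y" "- x"] sublinearD(5)[OF assms that, of y]
    by simp
  show "t \<ge> 0 \<Longrightarrow> tilt p y x \<le> p (x + t *\<^sub>R y) - t * p y"
    unfolding tilt_def by (rule cINF_lower) (auto intro!: bdd_belowI2[of _ "- p (- x)"] lower)
qed

lemma tilt_greatest:
  "(\<And>t. t \<ge> 0 \<Longrightarrow> b \<le> p (x + t *\<^sub>R y) - t * p y) \<Longrightarrow> b \<le> tilt p y x"
  unfolding tilt_def by (rule cINF_greatest) auto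

lemma sublinear_tilt:
  assumes p: "sublinear p" shows "sublinear (tilt p y)"
  unfolding sublinear_def
proof (intro conjI allI impI)
  fix x z
  have *: "tilt p y (x + z) - (p (x + s *\<^sub>R y) - s * p y) \<le> p (z + t *\<^sub>R y) - t * p y"
    if "s \<ge> 0" "t \<ge> 0" for s t
    using tilt_lower[OF p, of "s + t" y "x + z"] that
      sublinearD(1)[OF p, of "x + s *\<^sub>R y" "z + t *\<^sub>R y"]
    by (simp add: algebra_simps)
  have "tilt p y (x + z) - tilt p y z \<le> p (x + s *\<^sub>R y) - s * p y" if "s \<ge> 0" for s
    using tilt_greatest[of "tilt p y (x + z) - (p (x + s *\<^sub>R y) - s * p y)" p z y] *[OF that] by auto
  from tilt_greatest[OF this] show "tilt p y (x + z) \<le> tilt p y x + tilt p y z" by simp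
next
  fix c :: real and x assume c: "c > 0"
  have "tilt p y (c *\<^sub>R x) / c \<le> p (x + t *\<^sub>R y) - t * p y" if "t \<ge> 0" for t
  proof -
    have "tilt p y (c *\<^sub>R x) \<le> c * (p (x + t *\<^sub>R y) - t * p y)"
      using tilt_lower[OF p, of "c * t" y "c *\<^sub>R x"] that c
        sublinearD(5)[OF p, of c "x + t *\<^sub>R y"]
      by (simp add: algebra_simps)
    then show ?thesis using c by (simp add: pos_divide_le_eq mult.commute)
  qed
  from tilt_greatest[OF this] show "tilt p y (c *\<^sub>R x) \<le> c * tilt p y x"
    using c by (simp add: pos_divide_le_eq mult.commute)
qed

text \<open>Minimality forces \<open>tilt p y = p\<close> for every \<open>y\<close>, and the term \<open>t = 1\<close> of the infimum then
  gives \<open>p x \<le> p (x + y) - p y\<close>, the reverse of subadditivity.\<close>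

lemma sublinear_minimal_imp_linear:
  assumes p: "sublinear p" and min: "\<And>q. sublinear q \<Longrightarrow> (\<forall>x. q x \<le> p x) \<Longrightarrow> q = p"
  shows "linear p"
proof -
  have "tilt p y = p" for y
    using tilt_lower[OF p, of 0 y] by (intro min sublinear_tilt[OF p]) auto
  then have "p x + p y \<le> p (x + y)" for x y
    using tilt_lower[OF p, of 1 y x] by (simp)
  then have add: "p (x + y) = p x + p y" for x y using sublinearD(1)[OF p] by (simp add: antisym)
  have neg: "p (- x) = - p x" for x using add[of x "- x"] sublinearD(3)[OF p] by simp
  have "p (c *\<^sub>R x) = c * p x" for c x
  proof (cases "c \<ge> 0")
    case True then show ?thesis using sublinearD(5)[OF p] by blast
  next
    case False
    then have "p ((- c) *\<^sub>R x) = - c * p x" using sublinearD(5)[OF p, of "- c" x] by simp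
    then show ?thesis using neg[of "c *\<^sub>R x"] by simp
  qed
  then show ?thesis using add by (intro linearI) auto
qed

text \<open>Zorn's lemma applied to all sublinear functionals below \<open>q\<close> avoids extending functionals
  from subspaces. The infimum of a chain is finite because \<open>- q (- x) \<le> - p (- x) \<le> p x\<close>, and it is
  subadditive because two members of a chain have a common lower bound in it.\<close>

lemma hahn_banach_sublinear:
  fixes q :: "'a::real_vector \<Rightarrow> real"
  assumes q: "sublinear q"
  obtains f where "linear f" "\<And>x. f x \<le> q x"
proof -
  define A where "A = {p. sublinear p \<and> p \<le> q}"
  let ?P = "\<lambda>p r :: 'a \<Rightarrow> real. r \<le> p"
  have "\<exists>m\<in>A. \<forall>a\<in>A. ?P m a \<longrightarrow> a = m"
  proof (rule predicate_Zorn)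
    show "partial_order_on A (relation_of ?P A)"
      by (rule partial_order_on_relation_ofI) auto
    fix C assume "C \<in> Chains (relation_of ?P A)"
    then have CA: "C \<subseteq> A" and chain: "\<And>p r. p \<in> C \<Longrightarrow> r \<in> C \<Longrightarrow> p \<le> r \<or> r \<le> p"
      unfolding Chains_def relation_of_def by blast+
    show "\<exists>u\<in>A. \<forall>a\<in>C. u \<le> a"
    proof (cases "C = {}")
      case True then show ?thesis using q unfolding A_def by blast
    next
      case False
      define u where "u = (\<lambda>x. INF p\<in>C. p x)"
      have lower: "- q (- x) \<le> p x" if "p \<in> C" for p x
        using that CA sublinearD(4)[of p x] unfolding A_def le_fun_def
        by (smt (verit) mem_Collect_eq subsetD)
      have le: "u x \<le> p x" if "p \<in> C" for p x
        unfolding u_def using that lower by (intro cINF_lower bdd_belowI2[of _ "- q (- x)"])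
      have great: "b \<le> u x" if "\<And>p. p \<in> C \<Longrightarrow> b \<le> p x" for b x
        unfolding u_def using that False by (intro cINF_greatest)
      have "sublinear u" unfolding sublinear_def
      proof (intro conjI allI impI)
        fix x y
        have *: "u (x + y) - r y \<le> p x" if pr: "p \<in> C" "r \<in> C" for p r
        proof -
          obtain s where s: "s \<in> C" "s x \<le> p x" "s y \<le> r y"
            using chain[OF pr] pr unfolding le_fun_def by blast
          then have "s (x + y) \<le> s x + s y" using CA sublinearD(1) unfolding A_def by blast
          then show ?thesis using le[OF s(1), of "x + y"] s by simp
        qed
        have "u (x + y) - u x \<le> r y" if "r \<in> C" for r
          using great[of "u (x + y) - r y" x] *[OF _ that] by auto
        then have "u (x + y) - u x \<le> u y" by (rule great)
        then show "u (x + y) \<le> u x + u y" by simp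
      next
        fix c :: real and x assume c: "c > 0"
        have "u (c *\<^sub>R x) / c \<le> p x" if "p \<in> C" for p
        proof -
          have "p (c *\<^sub>R x) \<le> c * p x" using that CA sublinearD(2)[OF _ c] unfolding A_def by blast
          then show ?thesis using le[OF that, of "c *\<^sub>R x"] c by (simp add: pos_divide_le_eq mult.commute)
        qed
        from great[OF this] show "u (c *\<^sub>R x) \<le> c * u x"
          using c by (simp add: pos_divide_le_eq mult.commute)
      qed
      moreover have "u \<le> q" using False CA le unfolding A_def le_fun_def
        by (smt (verit) ex_in_conv mem_Collect_eq subsetD)
      ultimately show ?thesis using le unfolding A_def le_fun_def by blast
    qed
  qed
  then obtain m where m: "m \<in> A" "\<And>a. a \<in> A \<Longrightarrow> a \<le> m \<Longrightarrow> a = m" by blast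
  have "linear m"
    using m unfolding A_def
    by (intro sublinear_minimal_imp_linear) (auto simp: le_fun_def intro: order_trans)
  then show thesis using m(1) that unfolding A_def le_fun_def by blast
qed


section \<open>Separation of convex sets\<close>

definition minkowski_functional :: "'a::real_vector set \<Rightarrow> 'a \<Rightarrow> real" where
  "minkowski_functional U x = Inf {t. t > 0 \<and> (\<exists>u\<in>U. x = t *\<^sub>R u)}"

lemma minkowski_functional_le: "t > 0 \<Longrightarrow> u \<in> U \<Longrightarrow> minkowski_functional U (t *\<^sub>R u) \<le> t"
  unfolding minkowski_functional_def by (rule cInf_lower) (auto intro!: bdd_belowI[of _ 0])

lemma minkowski_functional_greatest:
  fixes U :: "'a::lctvs set"
  assumes "open U" "0 \<in> U" "\<And>t u. t > 0 \<Longrightarrow> u \<in> U \<Longrightarrow> x = t *\<^sub>R u \<Longrightarrow> b \<le> t"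
  shows "b \<le> minkowski_functional U x"
  unfolding minkowski_functional_def
proof (rule cInf_greatest)
  obtain r where r: "r > 0" "\<And>t. \<bar>t\<bar> < r \<Longrightarrow> 0 + t *\<^sub>R x \<in> U"
    using open_ray_radius[OF assms(1,2)] by blast
  then have "(r / 2) *\<^sub>R x \<in> U" "x = (2 / r) *\<^sub>R ((r / 2) *\<^sub>R x)"
    using r(2)[of "r / 2"] by auto
  then have "2 / r \<in> {t. t > 0 \<and> (\<exists>u\<in>U. x = t *\<^sub>R u)}" using r(1) by fastforce
  then show "{t. t > 0 \<and> (\<exists>u\<in>U. x = t *\<^sub>R u)} \<noteq> {}" by blast
qed (use assms(3) in blast)

lemma sublinear_minkowski_functional:
  fixes U :: "'a::lctvs set"
  assumes U: "open U" "convex U" "0 \<in> U"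
  shows "sublinear (minkowski_functional U)"
  unfolding sublinear_def
proof (intro conjI allI impI)
  fix x y :: 'a
  have *: "minkowski_functional U (x + y) \<le> s + t"
    if st: "s > 0" "u \<in> U" "x = s *\<^sub>R u" "t > 0" "v \<in> U" "y = t *\<^sub>R v" for s t u v
  proof -
    have "s + t \<noteq> 0" using st by simp
    then have "(s / (s + t)) *\<^sub>R u + (t / (s + t)) *\<^sub>R v \<in> U"
      using st by (intro convexD[OF U(2)]) (auto simp: add_divide_distrib[symmetric])
    moreover have "(s + t) *\<^sub>R ((s / (s + t)) *\<^sub>R u + (t / (s + t)) *\<^sub>R v) = x + y"
      using st \<open>s + t \<noteq> 0\<close> by (simp add: scaleR_add_right)
    ultimately show ?thesis using minkowski_functional_le[of "s + t" _ U] st by (metis add_pos_pos)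
  qed
  have "minkowski_functional U (x + y) - s \<le> minkowski_functional U y" if "s > 0" "u \<in> U" "x = s *\<^sub>R u" for s u
    by (rule minkowski_functional_greatest[OF U(1,3)]) (use *[OF that] in fastforce)
  then have "minkowski_functional U (x + y) - minkowski_functional U y \<le> minkowski_functional U x"
    by (intro minkowski_functional_greatest[OF U(1,3)]) fastforce
  then show "minkowski_functional U (x + y) \<le> minkowski_functional U x + minkowski_functional U y" by simp
next
  fix c :: real and x :: 'a assume c: "c > 0"
  have "minkowski_functional U (c *\<^sub>R x) / c \<le> minkowski_functional U x"
  proof (rule minkowski_functional_greatest[OF U(1,3)])
    fix t u assume tu: "t > 0" "u \<in> U" "x = t *\<^sub>R u"
    then show "minkowski_functional U (c *\<^sub>R x) / c \<le> t"
      using minkowski_functional_le[of "c * t" u U] c by (simp add: pos_divide_le_eq mult.commute)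
  qed
  then show "minkowski_functional U (c *\<^sub>R x) \<le> c * minkowski_functional U x"
    using c by (simp add: pos_divide_le_eq mult.commute)
qed

lemma linear_bounded_imp_dual_space:
  fixes f :: "'a::lctvs \<Rightarrow> real"
  assumes f: "linear f" and N: "open N" "0 \<in> N" "\<And>x. x \<in> N \<Longrightarrow> f x \<le> 1"
  shows "f \<in> dual_space"
proof -
  have "(f \<longlongrightarrow> f x) (at x)" for x
  proof (rule tendstoI)
    fix e :: real assume e: "e > 0"
    define d where "d = e / 2"
    have d: "d > 0" "d < e" using e by (auto simp: d_def)
    define W where "W = {y. (1 / d) *\<^sub>R y + (- (1 / d)) *\<^sub>R x \<in> N} \<inter>
      {y. (- (1 / d)) *\<^sub>R y + (1 / d) *\<^sub>R x \<in> N}"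
    have "open W" unfolding W_def by (intro open_Int open_affine_vimage N)
    moreover have "x \<in> W" using N by (simp add: W_def)
    moreover have "dist (f y) (f x) < e" if "y \<in> W" for y
    proof -
      have "(1 / d) * f y - (1 / d) * f x \<le> 1" "(1 / d) * f x - (1 / d) * f y \<le> 1"
        using that N(3)[of "(1 / d) *\<^sub>R y + (- (1 / d)) *\<^sub>R x"]
          N(3)[of "(- (1 / d)) *\<^sub>R y + (1 / d) *\<^sub>R x"]
        unfolding W_def by (auto simp: linear_add[OF f] linear_cmul[OF f] linear_diff[OF f] linear_neg[OF f])
      then have "\<bar>f y - f x\<bar> \<le> d" using d by (simp add: field_simps abs_le_iff)
      then show ?thesis using d by (simp add: dist_real_def)
    qed
    ultimately show "\<forall>\<^sub>F y in at x. dist (f y) (f x) < e"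
      unfolding eventually_at_topological by blast
  qed
  then show ?thesis using f unfolding dual_space_def continuous_on_def by simp
qed

text \<open>For \<open>a \<in> A\<close> the set \<open>a - A\<close> is a convex neighbourhood of \<open>0\<close> that misses \<open>a\<close>, so its Minkowski
  functional \<open>q\<close> has \<open>q a \<ge> 1\<close>. Hahn--Banach applied to \<open>q\<close> tilted in the direction \<open>a\<close> gives \<open>f \<le> q\<close>
  with \<open>f a \<ge> q a \<ge> 1\<close>, while \<open>f \<le> 1\<close> on \<open>a - A\<close>.\<close>

lemma separate_open_convex_from_zero:
  fixes A :: "'a::lctvs set"
  assumes A: "open A" "convex A" "0 \<notin> A" "A \<noteq> {}"
  obtains f v where "f \<in> dual_space" "f v > 0" "\<And>x. x \<in> A \<Longrightarrow> f x \<ge> 0"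
proof -
  obtain a where a: "a \<in> A" using A(4) by blast
  define U where "U = {x. (-1) *\<^sub>R x + a \<in> A}"
  have U: "open U" "0 \<in> U" "a \<notin> U" using A(1,3) a unfolding U_def
    by (auto intro: open_affine_vimage[of A "-1" a, simplified])
  have "convex U"
  proof (rule convexI)
    fix x y and u v :: real assume *: "x \<in> U" "y \<in> U" "0 \<le> u" "0 \<le> v" "u + v = 1"
    have "u *\<^sub>R (a - x) + v *\<^sub>R (a - y) \<in> A" using * by (intro convexD[OF A(2)]) (auto simp: U_def)
    moreover have "u *\<^sub>R (a - x) + v *\<^sub>R (a - y) = (u + v) *\<^sub>R a - (u *\<^sub>R x + v *\<^sub>R y)"
      by (simp add: algebra_simps)
    ultimately show "u *\<^sub>R x + v *\<^sub>R y \<in> U" using * by (simp add: U_def algebra_simps)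
  qed
  define q where "q = minkowski_functional U"
  have q: "sublinear q" unfolding q_def by (intro sublinear_minkowski_functional U \<open>convex U\<close>)
  have "1 \<le> q a" unfolding q_def
  proof (rule minkowski_functional_greatest[OF U(1,2)])
    fix t u assume tu: "t > 0" "u \<in> U" "a = t *\<^sub>R u"
    show "1 \<le> t"
    proof (rule ccontr)
      assume "\<not> 1 \<le> t"
      then have "t *\<^sub>R u + (1 - t) *\<^sub>R 0 \<in> U"
        using tu U by (intro convexD[OF \<open>convex U\<close>]) auto
      then show False using tu U by simp
    qed
  qed
  obtain f where f: "linear f" "\<And>x. f x \<le> tilt q a x"
    using hahn_banach_sublinear[OF sublinear_tilt[OF q]] by blast
  have fq: "f x \<le> q x" for x using f(2)[of x] tilt_lower[OF q, of 0 a x] by simp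
  have "f (- a) \<le> - q a"
    using f(2)[of "- a"] tilt_lower[OF q, of 1 a "- a"] sublinearD(3)[OF q] by simp
  then have fa: "1 \<le> f a" using \<open>1 \<le> q a\<close> linear_neg[OF f(1), of a] by simp
  have fU: "f x \<le> 1" if "x \<in> U" for x
    using fq[of x] minkowski_functional_le[OF _ that, of 1] unfolding q_def by simp
  have "f x \<ge> 0" if "x \<in> A" for x
    using fU[of "a - x"] that fa linear_diff[OF f(1)] by (simp add: U_def)
  then show thesis
    using that[of f a] linear_bounded_imp_dual_space[OF f(1) U(1,2) fU] fa by simp
qed

lemma linear_increases_on_open:
  fixes f :: "'a::lctvs \<Rightarrow> real"
  assumes "linear f" "f v > 0" "open S" "x \<in> S"
  obtains y where "y \<in> S" "f x < f y"
proof -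
  obtain r where r: "r > 0" "\<And>t. \<bar>t\<bar> < r \<Longrightarrow> x + t *\<^sub>R v \<in> S"
    using open_ray_radius[OF assms(3,4)] by blast
  have "f (x + (r / 2) *\<^sub>R v) = f x + (r / 2) * f v"
    using assms(1) by (simp add: linear_add linear_cmul)
  then show thesis using that[of "x + (r / 2) *\<^sub>R v"] r assms(2) by simp
qed

text \<open>Separation of the difference set from \<open>0\<close>. Strictness comes from the openness of \<open>S\<close>: a nonzero
  functional has no maximum on an open set.\<close>

lemma separate_open_convex:
  fixes S T :: "'a::lctvs set"
  assumes S: "open S" "convex S" "S \<noteq> {}" and T: "convex T" "T \<noteq> {}" and "S \<inter> T = {}"
  obtains f v where "f \<in> dual_space" "f v > 0" "\<And>x y. x \<in> S \<Longrightarrow> y \<in> T \<Longrightarrow> f x < f y"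
proof -
  define A where "A = (\<Union>y\<in>T. \<Union>x\<in>S. {y - x})"
  have "(\<exists>x\<in>S. z = y - x) \<longleftrightarrow> (-1) *\<^sub>R z + y \<in> S" for y z
  proof
    show "\<exists>x\<in>S. z = y - x" if "(-1) *\<^sub>R z + y \<in> S"
      using that by (rule rev_bexI) simp
  qed auto
  moreover have "A = (\<Union>y\<in>T. {z. \<exists>x\<in>S. z = y - x})" unfolding A_def by auto
  ultimately have "A = (\<Union>y\<in>T. {z. (-1) *\<^sub>R z + y \<in> S})" by (simp only:)
  then have "open A" by (simp only:) (intro open_UN ballI open_affine_vimage S(1))
  moreover have "convex A" unfolding A_def by (rule convex_differences[OF T(1) S(2)])
  moreover have "0 \<notin> A" "A \<noteq> {}" using assms unfolding A_def by auto
  ultimately obtain f v where f: "f \<in> dual_space" "f v > 0" "\<And>x. x \<in> A \<Longrightarrow> f x \<ge> 0"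
    by (rule separate_open_convex_from_zero) (rule that)
  have lin: "linear f" using f(1) by (simp add: dual_space_def)
  have le: "f x \<le> f y" if "x \<in> S" "y \<in> T" for x y
    using f(3)[of "y - x"] that linear_diff[OF lin] unfolding A_def by auto
  have "f x < f y" if x: "x \<in> S" and y: "y \<in> T" for x y
  proof -
    obtain x' where "x' \<in> S" "f x < f x'"
      using linear_increases_on_open[OF lin f(2) S(1) x] .
    then show ?thesis using le[OF _ y] by fastforce
  qed
  then show thesis by (rule that[OF f(1,2)])
qed

lemma locally_convex:
  fixes x :: "'a::lctvs"
  assumes "open U" "x \<in> U"
  obtains V where "open V" "convex V" "x \<in> V" "V \<subseteq> U"
proof -
  have "open {y. 1 *\<^sub>R y + x \<in> U}" "0 \<in> {y. 1 *\<^sub>R y + x \<in> U}"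
    using assms open_affine_vimage[OF assms(1), of 1 x] by auto
  then obtain V where V: "open V" "0 \<in> V" "convex V" "V \<subseteq> {y. 1 *\<^sub>R y + x \<in> U}"
    using locally_convex_zero by blast
  let ?W = "{y. 1 *\<^sub>R y + (- x) \<in> V}"
  have "?W = (+) x ` V"
  proof (intro equalityI subsetI)
    fix y assume "y \<in> ?W"
    then show "y \<in> (+) x ` V" by (intro image_eqI[of _ _ "y - x"]) auto
  qed auto
  then have "convex ?W" using V(3) by (simp add: convex_translation)
  moreover have "open ?W" by (rule open_affine_vimage[OF V(1)])
  moreover have "?W \<subseteq> U" using V(4) by force
  ultimately show thesis using that[of ?W] V(2) by simp
qed


section \<open>Linear functionals on int-nearly convex sets and epigraphs\<close>

lemma linear_bound_along_segment:
  fixes f :: "'a::real_vector \<Rightarrow> real"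
  assumes f: "linear f" and le: "\<And>t. 0 < t \<Longrightarrow> t < 1 \<Longrightarrow> f ((1 - t) *\<^sub>R y + t *\<^sub>R x) \<le> c"
  shows "f y \<le> c"
proof -
  have "((\<lambda>t. (1 - t) * f y + t * f x) \<longlongrightarrow> (1 - 0) * f y + 0 * f x) (at_right 0)"
    by (intro tendsto_intros)
  moreover have "\<forall>\<^sub>F t in at_right 0. (1 - t) * f y + t * f x \<le> c"
    unfolding eventually_at_right_field
    using le by (intro exI[of _ 1]) (simp add: linear_add[OF f] linear_cmul[OF f])
  ultimately have "(1 - 0) * f y + 0 * f x \<le> c" by (rule tendsto_upperbound) simp
  then show ?thesis by simp
qed

lemma linear_bound_extends_from_interior:
  fixes f :: "'a::lctvs \<Rightarrow> real"
  assumes "int_nearly_convex S" "interior S \<noteq> {}" and f: "linear f"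
    and le: "\<And>x. x \<in> interior S \<Longrightarrow> f x \<le> c" and y: "y \<in> S"
  shows "f y \<le> c"
proof -
  obtain x where "x \<in> interior S" using assms(2) by blast
  then show ?thesis
    using int_nearly_convex_segment[OF assms(1) _ y] linear_bound_along_segment[OF f, of y x] le
    by simp
qed

lemma interior_epi_down:
  fixes \<phi> :: "'a::lctvs \<Rightarrow> ereal"
  assumes "(w, l) \<in> interior (epi \<phi>)"
  obtains l' where "l' < l" "\<phi> w \<le> ereal l'"
proof -
  obtain r where "r > 0" and r: "\<And>t. \<bar>t\<bar> < r \<Longrightarrow> (w, l) + t *\<^sub>R (0, 1) \<in> interior (epi \<phi>)"
    using open_ray_radius[OF open_interior assms] by blast
  have "(w, l) + (- (r / 2)) *\<^sub>R (0, 1) \<in> epi \<phi>"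
    using r[of "- (r / 2)"] \<open>r > 0\<close> interior_subset by fastforce
  then show thesis using that[of "l - r / 2"] \<open>r > 0\<close> by (simp add: epi_def)
qed

lemma linear_prod_real:
  fixes f :: "'a::real_vector \<times> real \<Rightarrow> real"
  assumes "linear f"
  shows "f (w, l) = f (w, 0) + l * f (0, 1)"
  using linear_add[OF assms, of "(w, 0)" "l *\<^sub>R (0, 1)"] linear_cmul[OF assms, of l "(0, 1)"] by simp

lemma dual_space_fst:
  fixes f :: "'a::lctvs \<times> 'b::lctvs \<Rightarrow> real"
  assumes "f \<in> dual_space" shows "(\<lambda>w. f (w, 0)) \<in> dual_space"
proof -
  have lin: "linear f" and cont: "continuous_on UNIV f" using assms by (auto simp: dual_space_def)
  have "linear (\<lambda>w. f (w, 0))"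
    using linear_add[OF lin, of "(_, 0)" "(_, 0)"] linear_cmul[OF lin, of _ "(_, 0)"]
    by (intro linearI) auto
  moreover have "continuous_on UNIV (\<lambda>w. f (w, 0))"
    by (rule continuous_on_compose2[OF cont]) (auto intro!: continuous_intros)
  ultimately show ?thesis by (simp add: dual_space_def)
qed

lemma dual_space_snd:
  fixes f :: "'a::lctvs \<times> 'b::lctvs \<Rightarrow> real"
  assumes "f \<in> dual_space" shows "(\<lambda>v. f (0, v)) \<in> dual_space"
proof -
  have lin: "linear f" and cont: "continuous_on UNIV f" using assms by (auto simp: dual_space_def)
  have "linear (\<lambda>w. f (0, w))"
    using linear_add[OF lin, of "(0, _)" "(0, _)"] linear_cmul[OF lin, of _ "(0, _)"]
    by (intro linearI) auto
  moreover have "continuous_on UNIV (\<lambda>w. f (0, w))"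
    by (rule continuous_on_compose2[OF cont]) (auto intro!: continuous_intros)
  ultimately show ?thesis by (simp add: dual_space_def)
qed

lemma dual_space_lincomb:
  assumes "f \<in> dual_space" "g \<in> dual_space"
  shows "(\<lambda>x. a * f x + b * g x) \<in> dual_space"
proof -
  have "linear f" "linear g" using assms by (auto simp: dual_space_def)
  then have "linear (\<lambda>x. a * f x + b * g x)"
    by (intro linearI) (simp_all add: linear_add linear_cmul algebra_simps)
  with assms show ?thesis by (auto simp: dual_space_def intro!: continuous_intros)
qed

section \<open>Sum rule for approximate subdifferentials\<close>

text \<open>Hypothesis \<open>sub\<close> says that \<open>s\<close> is an \<open>E\<close>-subgradient at \<open>z\<close> of the sum of \<open>\<phi>\<close> and the indicator
  function of \<open>S\<close>. A hyperplane separating \<open>interior (epi \<phi>)\<close> from the points over \<open>interior S\<close> that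
  lie on or below the affine function \<open>w \<mapsto> s (w - z) + r - E\<close> is the graph of an affine function
  with slope \<open>p\<close> between the two. The error \<open>E\<close> is divided by giving to the normal cone exactly what
  \<open>s - p\<close> needs, its supremum over \<open>S - z\<close>, and the remainder to \<open>\<phi>\<close>.\<close>

lemma eps_subdifferential_sum_rule:
  fixes \<phi> :: "'a::lctvs \<Rightarrow> ereal"
  assumes phi: "int_nearly_convex_fun \<phi>" and S: "int_nearly_convex S"
    and w0: "(w0, l0) \<in> interior (epi \<phi>)" "w0 \<in> interior S"
    and z: "z \<in> S" "\<phi> z = ereal r" and s: "s \<in> dual_space"
    and sub: "\<And>w. w \<in> S \<Longrightarrow> ereal (s (w - z) + r - E) \<le> \<phi> w"
  obtains e1 e2 p where "e1 \<ge> 0" "e2 \<ge> 0" "e1 + e2 = E"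
    "p \<in> eps_subdifferential e1 \<phi> z" "(\<lambda>w. s w - p w) \<in> eps_normal_cone e2 z S"
proof -
  have ls: "linear s" using s by (simp add: dual_space_def)
  have epi: "int_nearly_convex (epi \<phi>)" using phi by (simp add: int_nearly_convex_fun_def)
  define T where "T = {(w, l). w \<in> interior S \<and> l \<le> s (w - z) + r - E}"
  have "convex T"
  proof (rule convexI)
    fix x y :: "'a \<times> real" and u v :: real
    assume *: "x \<in> T" "y \<in> T" "0 \<le> u" "0 \<le> v" "u + v = 1"
    obtain w l w' l' where [simp]: "x = (w, l)" "y = (w', l')" by fastforce
    have "u *\<^sub>R w + v *\<^sub>R w' \<in> interior S"
      using * int_nearly_convex_convex_interior[OF S] by (intro convexD) (auto simp: T_def)
    moreover have "u * l + v * l' \<le> u * (s w - s z + r - E) + v * (s w' - s z + r - E)"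
      using * by (intro add_mono mult_left_mono) (auto simp: T_def linear_diff[OF ls])
    moreover have "\<dots> = u * s w + v * s w' + (u + v) * (r - E - s z)" by (simp add: algebra_simps)
    ultimately show "u *\<^sub>R x + v *\<^sub>R y \<in> T"
      using * by (simp add: T_def linear_diff[OF ls] linear_add[OF ls] linear_cmul[OF ls])
  qed
  moreover have w0T: "(w0, s (w0 - z) + r - E) \<in> T" using w0 by (simp add: T_def)
  moreover have disj: "interior (epi \<phi>) \<inter> T = {}"
  proof -
    have False if int: "(w, l) \<in> interior (epi \<phi>)" and T: "(w, l) \<in> T" for w l
    proof -
      obtain l' where l': "l' < l" "\<phi> w \<le> ereal l'" using int by (rule interior_epi_down)
      have "w \<in> S" using T interior_subset unfolding T_def by blast
      then have "ereal (s (w - z) + r - E) \<le> ereal l'" using sub l'(2) by (meson order_trans)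
      then show False using l' T by (simp add: T_def)
    qed
    then show ?thesis by auto
  qed
  moreover have "convex (interior (epi \<phi>))" "interior (epi \<phi>) \<noteq> {}"
    using int_nearly_convex_convex_interior[OF epi] w0 by auto
  ultimately obtain f v where f: "f \<in> dual_space"
    "\<And>x y. x \<in> interior (epi \<phi>) \<Longrightarrow> y \<in> T \<Longrightarrow> f x < f y"
    using w0T by (elim separate_open_convex[OF open_interior, of "epi \<phi>" T]) auto
  have lf: "linear f" using f by (simp add: dual_space_def)
  define k where "k = - f (0, 1)"
  define q where "q w = f (w, 0)" for w
  have fk: "f (w, l) = q w - k * l" for w l
    unfolding q_def k_def using linear_prod_real[OF lf, of w l] by simp
  have q: "q \<in> dual_space" unfolding q_def by (rule dual_space_fst[OF f(1)])
  then have lq: "linear q" by (simp add: dual_space_def)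
  \<comment> \<open>the hyperplane is not vertical: both sets have a point over \<open>w0\<close>, and it separates them strictly\<close>
  have "k > 0"
  proof -
    have "\<not> l0 \<le> s (w0 - z) + r - E" using disj w0 by (auto simp: T_def)
    moreover have "k * (s (w0 - z) + r - E) < k * l0" using f(2)[OF w0(1) w0T] by (simp add: fk)
    ultimately show ?thesis by (smt (verit) mult_left_mono_neg)
  qed
  have 1: "f x \<le> q w' - k * (s (w' - z) + r - E)" if "x \<in> epi \<phi>" "w' \<in> interior S" for x w'
  proof (rule linear_bound_extends_from_interior[OF epi _ lf _ that(1)])
    fix x assume "x \<in> interior (epi \<phi>)"
    then show "f x \<le> q w' - k * (s (w' - z) + r - E)"
      using f(2)[of x "(w', s (w' - z) + r - E)"] that(2) by (simp add: T_def fk)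
  qed (use w0 in auto)
  have lks: "linear (\<lambda>w. k * s w - q w)"
    using dual_space_lincomb[OF s q, of k "-1"] by (simp add: dual_space_def)
  have 2: "k * s w' - q w' \<le> k * (s z - r + E) - f x" if "x \<in> epi \<phi>" "w' \<in> S" for x w'
  proof (rule linear_bound_extends_from_interior[OF S _ lks _ that(2)])
    fix w assume "w \<in> interior S"
    from 1[OF that(1) this] show "k * s w - q w \<le> k * (s z - r + E) - f x"
      by (simp add: linear_diff[OF ls] algebra_simps)
  qed (use w0 in auto)
  define p where "p w = q w / k" for w
  define n where "n w = s w - p w" for w
  have p: "p \<in> dual_space"
    using dual_space_lincomb[OF q q, of "1 / k" 0] unfolding p_def by simp
  have n: "n \<in> dual_space"
    using dual_space_lincomb[OF s p, of 1 "-1"] unfolding n_def by simp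
  have lp: "linear p" and ln: "linear n" using p n by (auto simp: dual_space_def)
  have key: "n (w' - z) \<le> E + l - r - p (w - z)" if "\<phi> w \<le> ereal l" "w' \<in> S" for w w' l
  proof -
    have "k * s w' - q w' \<le> k * (s z - r + E) - q w + k * l"
      using 2[of "(w, l)" w'] that by (simp add: epi_def fk)
    moreover have "q w = k * p w" for w using \<open>k > 0\<close> by (simp add: p_def)
    ultimately have "k * (s w' - p w') \<le> k * (s z - r + E - p w + l)" by (simp add: algebra_simps)
    then have "s w' - p w' \<le> s z - r + E - p w + l" using \<open>k > 0\<close> by simp
    then show ?thesis by (simp add: n_def linear_diff[OF lp] linear_diff[OF ls])
  qed
  \<comment> \<open>the least error for which \<open>n\<close> is an approximate normal to \<open>S\<close> at \<open>z\<close>\<close>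
  define e2 where "e2 = (SUP w\<in>S. n (w - z))"
  have le2: "n (w - z) \<le> e2" if "w \<in> S" for w
    unfolding e2_def using key[of z r] z linear_0[OF lp] that
    by (intro cSUP_upper bdd_aboveI2[of _ _ E]) auto
  have e2le: "e2 \<le> E + l - r - p (w - z)" if "\<phi> w \<le> ereal l" for w l
    unfolding e2_def using key[OF that] z by (intro cSUP_least) auto
  have "e2 \<ge> 0" using le2[OF z(1)] linear_0[OF ln] by simp
  moreover have "E - e2 \<ge> 0" using e2le[of z r] z linear_0[OF lp] by simp
  moreover have "p \<in> eps_subdifferential (E - e2) \<phi> z"
  proof -
    have "ereal (p (w - z)) \<le> \<phi> w - ereal r + ereal (E - e2)" for w
    proof (cases "\<phi> w")
      case (real l)
      then show ?thesis using e2le[of w l] by simp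
    next
      case MInf
      \<comment> \<open>a value \<open>- \<infinity>\<close> would allow every \<open>l\<close> in \<open>e2le\<close>, so one violating it by \<open>1\<close> refutes this case\<close>
      then show ?thesis using e2le[of w "e2 - E + r + p (w - z) - 1"] by simp
    qed simp
    then show ?thesis using p z by (simp add: eps_subdifferential_def)
  qed
  moreover have "(\<lambda>w. s w - p w) \<in> eps_normal_cone e2 z S"
    using n le2 unfolding eps_normal_cone_def n_def by simp
  ultimately show thesis using that[of "E - e2" e2 p] by simp
qed

section \<open>Conjugates of optimal value functions\<close>

text \<open>Quantifying over the real numbers above \<open>\<phi> (u, v)\<close> replaces extended arithmetic by linear
  inequalities on \<open>epi \<phi>\<close>, uniformly in the cases \<open>\<phi> (u, v) = \<plusminus>\<infinity>\<close>.\<close>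

lemma conjugate_optimal_value_le_iff:
  "conjugate (optimal_value \<phi> F) xs \<le> ereal m \<longleftrightarrow>
    (\<forall>u. \<forall>v\<in>F u. \<forall>l. \<phi> (u, v) \<le> ereal l \<longrightarrow> xs u - l \<le> m)"
proof -
  have 1: "ereal a - b \<le> ereal m \<longleftrightarrow> ereal (a - m) \<le> b" for a b
    by (cases b) auto
  have 2: "ereal (a - m) \<le> b \<longleftrightarrow> (\<forall>l. b \<le> ereal l \<longrightarrow> a - l \<le> m)" for a b
  proof (cases b)
    case (real r) then show ?thesis by force
  next
    case MInf
    have "\<not> a - (a - m - 1) \<le> m" by simp
    then show ?thesis using MInf by (auto intro!: exI[of _ "a - m - 1"])
  qed simp
  show ?thesis
    unfolding conjugate_def optimal_value_def SUP_le_iff 1 le_INF_iff 2 by auto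
qed

text \<open>Suppose that a convex neighbourhood \<open>N\<close> of \<open>(x, \<alpha>)\<close>, where \<open>\<alpha> = x0s x - m + \<epsilon>\<close>, misses the
  projection of the part of \<open>interior (epi \<phi>)\<close> over \<open>interior (gph F)\<close>. A separating functional \<open>(u, l) \<mapsto> p u + a l\<close> is
  at least \<open>c\<close> on the projection and smaller than \<open>c\<close> at \<open>(x, \<alpha>)\<close>, with \<open>a \<ge> 0\<close>. For \<open>t > 0\<close> the
  functional \<open>xs = (x0s - t p) / (1 + t a)\<close> has conjugate value at most \<open>(m - t c) / (1 + t a)\<close>, and
  the subgradient inequality at \<open>xs\<close> bounds \<open>t (c - p x - a \<alpha>)\<close> by \<open>\<epsilon>\<close>, which fails for large \<open>t\<close>.
  Starting from \<open>x0s\<close>, rather than from the functional \<open>- p / a\<close>, treats vertical hyperplanes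
  (\<open>a = 0\<close>) together with the others.\<close>

lemma eps_subdifferential_dual_approx:
  fixes \<phi> :: "'a::lctvs \<times> 'b::lctvs \<Rightarrow> ereal"
  assumes phi: "int_nearly_convex_fun \<phi>" and F: "int_nearly_convex_map F"
    and w0: "(w0, l0) \<in> interior (epi \<phi>)" "w0 \<in> interior (gph F)"
    and x0s: "x0s \<in> dual_space" "conjugate (optimal_value \<phi> F) x0s = ereal m"
    and x: "x \<in> eps_subdifferential_dual \<epsilon> (conjugate (optimal_value \<phi> F)) x0s"
    and U: "open U" "x \<in> U" and eta: "\<eta> > 0"
  obtains u v l where "u \<in> U" "v \<in> F u" "\<phi> (u, v) \<le> ereal l" "l < x0s u - m + \<epsilon> + \<eta>"
proof (rule ccontr)
  note witness = that
  assume contra: "\<not> thesis"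
  have none: False if "u \<in> U" "v \<in> F u" "\<phi> (u, v) \<le> ereal l" "l < x0s u - m + \<epsilon> + \<eta>" for u v l
    using contra witness[OF that] by (rule notE)
  have epi: "int_nearly_convex (epi \<phi>)" and gph: "int_nearly_convex (gph F)"
    using phi F by (auto simp: int_nearly_convex_fun_def int_nearly_convex_map_def)
  have lx0s: "linear x0s" using x0s by (simp add: dual_space_def)
  define \<alpha> where "\<alpha> = x0s x - m + \<epsilon>"
  define V where "V = (U \<times> UNIV) \<inter> {y. snd y < x0s (fst y) - m + \<epsilon> + \<eta>}"
  have "continuous_on UNIV (\<lambda>y::'a\<times>real. x0s (fst y))"
    using x0s(1) by (intro continuous_on_compose2[of UNIV x0s UNIV fst] continuous_on_fst continuous_on_id)
      (simp_all add: dual_space_def)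
  then have "open {y::'a\<times>real. snd y < x0s (fst y) - m + \<epsilon> + \<eta>}"
    by (intro open_Collect_less continuous_on_add continuous_on_diff continuous_on_const
        continuous_on_snd continuous_on_id)
  then have "open V" unfolding V_def using U by (intro open_Int open_Times open_UNIV)
  moreover have "(x, \<alpha>) \<in> V" using U eta by (simp add: V_def \<alpha>_def)
  ultimately obtain N where N: "open N" "convex N" "(x, \<alpha>) \<in> N" "N \<subseteq> V" by (rule locally_convex)
  define D where "D = interior (epi \<phi>) \<inter> (interior (gph F) \<times> UNIV)"
  define \<pi> :: "('a \<times> 'b) \<times> real \<Rightarrow> 'a \<times> real" where "\<pi> = (\<lambda>y. (fst (fst y), snd y))"
  have "linear \<pi>" unfolding \<pi>_def by (intro linearI) auto
  have "convex D" unfolding D_def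
    using int_nearly_convex_convex_interior[OF epi] int_nearly_convex_convex_interior[OF gph]
    by (intro convex_Int convex_Times convex_UNIV)
  then have cD: "convex (\<pi> ` D)" using \<open>linear \<pi>\<close> by (rule convex_linear_image[rotated])
  have ne: "N \<noteq> {}" "\<pi> ` D \<noteq> {}" using N(3) w0 by (auto simp: D_def)
  have "N \<inter> \<pi> ` D = {}"
  proof -
    have False if "((u, v), l) \<in> D" "(u, l) \<in> N" for u v l
    proof -
      have "((u, v), l) \<in> epi \<phi>" "(u, v) \<in> gph F"
        using that(1) interior_subset unfolding D_def by blast+
      then have "v \<in> F u" "\<phi> (u, v) \<le> ereal l" by (auto simp: gph_def epi_def)
      moreover have "u \<in> U" "l < x0s u - m + \<epsilon> + \<eta>" using that(2) N(4) by (auto simp: V_def)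
      ultimately show False by (intro none)
    qed
    then show ?thesis by (auto simp: \<pi>_def)
  qed
  then obtain f v where f: "f \<in> dual_space" "f v > 0"
    "\<And>y d. y \<in> N \<Longrightarrow> d \<in> \<pi> ` D \<Longrightarrow> f y < f d"
    by (rule separate_open_convex[OF N(1,2) ne(1) cD ne(2)]) (rule that)
  have lf: "linear f" using f by (simp add: dual_space_def)
  \<comment> \<open>a value of \<open>f\<close> on \<open>N\<close> above the one at \<open>(x, \<alpha>)\<close> bounds \<open>f\<close> on the projection away from it\<close>
  obtain y where y: "y \<in> N" "f (x, \<alpha>) < f y" using linear_increases_on_open[OF lf f(2) N(1,3)] by blast
  define c where "c = f y"
  define p where "p u = f (u, 0)" for u
  define a where "a = f (0, 1)"
  have fp: "f (u, l) = p u + a * l" for u l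
    unfolding p_def a_def using linear_prod_real[OF lf, of u l] by simp
  have p: "p \<in> dual_space" unfolding p_def by (rule dual_space_fst[OF f(1)])
  have bound: "c \<le> p u + a * l" if vF: "v \<in> F u" and l: "\<phi> (u, v) \<le> ereal l" for u v l
  proof -
    have "linear (\<lambda>y. - f (\<pi> y))"
      using linear_compose[OF \<open>linear \<pi>\<close> lf] by (simp add: o_def linear_compose_neg)
    then have "- f (\<pi> ((u, v), l)) \<le> - c"
    proof (rule linear_bound_along_segment)
      fix t :: real assume t: "0 < t" "t < 1"
      have "(1 - t) *\<^sub>R ((u, v), l) + t *\<^sub>R (w0, l0) \<in> interior (epi \<phi>)"
        using t l by (intro int_nearly_convex_segment[OF epi w0(1)]) (auto simp: epi_def)
      moreover have "(1 - t) *\<^sub>R (u, v) + t *\<^sub>R w0 \<in> interior (gph F)"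
        using t vF by (intro int_nearly_convex_segment[OF gph w0(2)]) (auto simp: gph_def)
      ultimately have "(1 - t) *\<^sub>R ((u, v), l) + t *\<^sub>R (w0, l0) \<in> D" by (simp add: D_def)
      then have "c \<le> f (\<pi> ((1 - t) *\<^sub>R ((u, v), l) + t *\<^sub>R (w0, l0)))"
        unfolding c_def using f(3)[OF y(1)] by (intro less_imp_le) blast
      then show "- f (\<pi> ((1 - t) *\<^sub>R ((u, v), l) + t *\<^sub>R (w0, l0))) \<le> - c" by simp
    qed
    then show ?thesis by (simp add: \<pi>_def fp)
  qed
  obtain u0 v0 where uv0: "w0 = (u0, v0)" by fastforce
  have "(w0, l0) \<in> epi \<phi>" "w0 \<in> gph F" using w0 interior_subset by blast+
  then have v0: "v0 \<in> F u0" and l0: "\<phi> (u0, v0) \<le> ereal l0"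
    by (auto simp: uv0 gph_def epi_def)
  \<comment> \<open>the epigraph is unbounded above, so \<open>bound\<close> would fail at height \<open>l0 + k\<close> if \<open>a\<close> were negative\<close>
  have "a \<ge> 0"
  proof (rule ccontr)
    assume "\<not> a \<ge> 0"
    define k where "k = max 0 ((c - 1 - p u0 - a * l0) / a)"
    have "\<phi> (u0, v0) \<le> ereal (l0 + k)" by (rule order_trans[OF l0]) (simp add: k_def)
    then have "c \<le> p u0 + a * (l0 + k)" by (rule bound[OF v0])
    moreover have "a * k \<le> c - 1 - p u0 - a * l0"
      using \<open>\<not> a \<ge> 0\<close> unfolding k_def by (simp add: max_def field_simps)
    ultimately show False by (simp add: algebra_simps)
  qed
  define \<delta> where "\<delta> = c - f (x, \<alpha>)"
  have "\<delta> > 0" using y by (simp add: \<delta>_def c_def)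
  have small: "t * \<delta> \<le> \<epsilon>" if t: "t > 0" for t
  proof -
    define b where "b = 1 + t * a"
    have b: "b > 0" using t \<open>a \<ge> 0\<close> by (simp add: b_def add_pos_nonneg)
    define xs where "xs = (\<lambda>u. (1 / b) * x0s u + (- t / b) * p u)"
    have xs: "xs \<in> dual_space" unfolding xs_def by (rule dual_space_lincomb[OF x0s(1) p])
    have bxs: "b * xs u = x0s u - t * p u" for u using b by (simp add: xs_def field_simps)
    have "conjugate (optimal_value \<phi> F) xs \<le> ereal ((m - t * c) / b)"
      unfolding conjugate_optimal_value_le_iff
    proof (intro allI ballI impI)
      fix u v l assume *: "v \<in> F u" "\<phi> (u, v) \<le> ereal l"
      have "x0s u - l \<le> m"
        using * conjugate_optimal_value_le_iff[of \<phi> F x0s m] x0s(2) by auto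
      moreover have "t * c \<le> t * (p u + a * l)" using bound[OF *] t by (intro mult_left_mono) auto
      ultimately have "b * (xs u - l) \<le> m - t * c"
        unfolding right_diff_distrib bxs by (simp add: b_def algebra_simps)
      then show "xs u - l \<le> (m - t * c) / b" using b by (simp add: pos_le_divide_eq mult.commute)
    qed
    moreover have "ereal (xs x - x0s x) \<le> conjugate (optimal_value \<phi> F) xs - ereal m + ereal \<epsilon>"
      using x xs x0s(2) unfolding eps_subdifferential_dual_def by simp
    ultimately have "ereal (xs x - x0s x) \<le> ereal ((m - t * c) / b) - ereal m + ereal \<epsilon>"
      by (meson add_right_mono ereal_minus_mono order_refl order_trans)
    then have "xs x - x0s x + m - \<epsilon> \<le> (m - t * c) / b" by simp
    then have "b * (xs x - x0s x + m - \<epsilon>) \<le> m - t * c" using b by (simp add: pos_le_divide_eq mult.commute)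
    moreover have "b * (xs x - x0s x + m - \<epsilon>) = x0s x - t * p x - b * \<alpha>"
      using bxs[of x] by (simp add: \<alpha>_def algebra_simps)
    ultimately show ?thesis by (simp add: \<delta>_def fp b_def \<alpha>_def algebra_simps)
  qed
  have "((\<bar>\<epsilon>\<bar> + 1) / \<delta>) * \<delta> \<le> \<epsilon>" using \<open>\<delta> > 0\<close> by (intro small) simp
  then show False using \<open>\<delta> > 0\<close> by simp
qed


section \<open>Subdifferential of the conjugate\<close>

text \<open>The union over all splittings of the error collapses to one inequality: the pair \<open>(x, y)\<close> is
  optimal up to \<open>E\<close> in the supremum defining the conjugate at \<open>x0s\<close>. From right to left, the sum rule
  is applied to the functional \<open>(u, v) \<mapsto> x0s u\<close>; since it does not depend on \<open>v\<close>, the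
  \<open>'b\<close>-components of the two parts are opposite, as the sign in the coderivative requires.\<close>

lemma eps_chain_rule_iff:
  fixes \<phi> :: "'a::lctvs \<times> 'b::lctvs \<Rightarrow> ereal"
  assumes phi: "int_nearly_convex_fun \<phi>" and F: "int_nearly_convex_map F"
    and w0: "(w0, l0) \<in> interior (epi \<phi>)" "w0 \<in> interior (gph F)"
    and x0s: "x0s \<in> dual_space" and y: "y \<in> F x"
  shows "(\<exists>e1 e2 x1s y1s x2s. e1 + e2 = E \<and> e1 \<ge> 0 \<and> e2 \<ge> 0 \<and>
      (x1s, y1s) \<in> eps_subdifferential_pairs e1 \<phi> (x, y) \<and>
      x2s \<in> eps_coderivative e2 F (x, y) y1s \<and> x0s = (\<lambda>u. x1s u + x2s u)) \<longleftrightarrow>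
    (\<exists>r. \<phi> (x, y) = ereal r \<and> conjugate (optimal_value \<phi> F) x0s \<le> ereal (x0s x - r + E))"
    (is "?L \<longleftrightarrow> ?R")
proof
  assume ?L
  then obtain e1 e2 x1s y1s x2s where E: "e1 + e2 = E"
    and 1: "(x1s, y1s) \<in> eps_subdifferential_pairs e1 \<phi> (x, y)"
    and 2: "x2s \<in> eps_coderivative e2 F (x, y) y1s" and x0s_eq: "x0s = (\<lambda>u. x1s u + x2s u)"
    by blast
  have sub: "pair_functional x1s y1s \<in> eps_subdifferential e1 \<phi> (x, y)"
    using 1 by (simp add: eps_subdifferential_pairs_def)
  then obtain r where r: "\<phi> (x, y) = ereal r"
    unfolding eps_subdifferential_def by (cases "\<phi> (x, y)") auto
  have lin: "linear x1s" "linear y1s" "linear x2s"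
    using 1 2 by (auto simp: eps_subdifferential_pairs_def eps_coderivative_def dual_space_def)
  have "x0s u - l \<le> x0s x - r + E" if "v \<in> F u" "\<phi> (u, v) \<le> ereal l" for u v l
  proof -
    have "ereal (x1s (u - x) + y1s (v - y)) \<le> \<phi> (u, v) - ereal r + ereal e1"
      using sub r unfolding eps_subdifferential_def pair_functional_def by force
    also have "\<dots> \<le> ereal l - ereal r + ereal e1"
      using that by (intro add_right_mono ereal_minus_mono) auto
    finally have "x1s (u - x) + y1s (v - y) \<le> l - r + e1" by simp
    moreover have "x2s (u - x) - y1s (v - y) \<le> e2"
      using 2 that(1) unfolding eps_coderivative_def eps_normal_cone_def pair_functional_def gph_def
      by force
    ultimately show ?thesis
      using E by (simp add: x0s_eq linear_diff[OF lin(1)] linear_diff[OF lin(3)])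
  qed
  then show ?R using r by (auto simp: conjugate_optimal_value_le_iff)
next
  assume ?R
  then obtain r where r: "\<phi> (x, y) = ereal r"
    and conj: "\<And>u v l. v \<in> F u \<Longrightarrow> \<phi> (u, v) \<le> ereal l \<Longrightarrow> x0s u - l \<le> x0s x - r + E"
    unfolding conjugate_optimal_value_le_iff by blast
  have lx0s: "linear x0s" using x0s by (simp add: dual_space_def)
  define s :: "'a \<times> 'b \<Rightarrow> real" where "s = (\<lambda>w. x0s (fst w))"
  have "linear s" using lx0s unfolding s_def
    by (intro linearI) (auto simp: linear_add linear_cmul)
  moreover have "continuous_on UNIV s" unfolding s_def using x0s
    by (intro continuous_on_compose2[of UNIV x0s UNIV fst] continuous_on_fst continuous_on_id)
      (simp_all add: dual_space_def)
  ultimately have s: "s \<in> dual_space" by (simp add: dual_space_def)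
  have sub: "ereal (s (w - (x, y)) + r - E) \<le> \<phi> w" if "w \<in> gph F" for w
  proof -
    obtain u v where w: "w = (u, v)" by fastforce
    have v: "v \<in> F u" using that by (simp add: w gph_def)
    show ?thesis
    proof (cases "\<phi> (u, v)")
      case (real l)
      then show ?thesis using conj[OF v, of l] by (simp add: w s_def linear_diff[OF lx0s])
    next
      case MInf
      then show ?thesis using conj[OF v, of "x0s u - x0s x + r - E - 1"] by simp
    qed (simp add: w)
  qed
  obtain e1 e2 p where e: "e1 \<ge> 0" "e2 \<ge> 0" "e1 + e2 = E"
    and p: "p \<in> eps_subdifferential e1 \<phi> (x, y)"
    and n: "(\<lambda>w. s w - p w) \<in> eps_normal_cone e2 (x, y) (gph F)"
    using eps_subdifferential_sum_rule[OF phi _ w0 _ r s sub] F y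
    unfolding int_nearly_convex_map_def gph_def by blast
  have pd: "p \<in> dual_space" using p unfolding eps_subdifferential_def by (auto split: if_splits)
  then have lp: "linear p" by (simp add: dual_space_def)
  define x1s where "x1s = (\<lambda>u. p (u, 0))"
  define y1s where "y1s = (\<lambda>v. p (0, v))"
  define x2s where "x2s = (\<lambda>u. x0s u - x1s u)"
  have dual: "x1s \<in> dual_space" "y1s \<in> dual_space"
    unfolding x1s_def y1s_def by (rule dual_space_fst[OF pd], rule dual_space_snd[OF pd])
  have x2: "x2s \<in> dual_space"
    using dual_space_lincomb[OF x0s dual(1), of 1 "-1"] unfolding x2s_def by simp
  have split: "p (u, v) = x1s u + y1s v" for u v
    using linear_add[OF lp, of "(u, 0)" "(0, v)"] by (simp add: x1s_def y1s_def)
  have "pair_functional x1s y1s = p"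
    by (auto simp: pair_functional_def fun_eq_iff split)
  then have "(x1s, y1s) \<in> eps_subdifferential_pairs e1 \<phi> (x, y)"
    using p dual by (simp add: eps_subdifferential_pairs_def)
  moreover have "pair_functional x2s (\<lambda>v. - y1s v) = (\<lambda>w. s w - p w)"
    by (auto simp: pair_functional_def fun_eq_iff split x2s_def s_def)
  then have "x2s \<in> eps_coderivative e2 F (x, y) y1s"
    using n x2 by (simp add: eps_coderivative_def)
  moreover have "x0s = (\<lambda>u. x1s u + x2s u)" by (simp add: x2s_def)
  ultimately show ?L using e by blast
qed

theorem theorem6p5:
  fixes \<phi> :: "'a::lctvs \<times> 'b::lctvs \<Rightarrow> ereal"
    and F :: "'a \<Rightarrow> 'b set"
    and \<mu> :: "'a \<Rightarrow> ereal"
    and \<epsilon> :: real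
    and x0s :: "'a \<Rightarrow> real"
  assumes "int_nearly_convex_fun \<phi>"
    and "int_nearly_convex_map F"
    and "\<mu> = optimal_value \<phi> F"
    and "proper_on UNIV \<mu>"
    and "interior (epi \<phi>) \<inter> interior (gph F \<times> {0..}) \<noteq> {}"
    and "proper_on dual_space (conjugate \<mu>)"
    and "\<epsilon> \<ge> 0"
    and "x0s \<in> dual_space"
    and "\<bar>conjugate \<mu> x0s\<bar> \<noteq> \<infinity>"
  shows "eps_subdifferential_dual \<epsilon> (conjugate \<mu>) x0s =
    (\<Inter>\<eta>\<in>{0<..}. closure {x. \<exists>y\<in>F x. x0s \<in>
      (\<Union>(\<epsilon>1, \<epsilon>2)\<in>{(\<epsilon>1, \<epsilon>2). \<epsilon>1 + \<epsilon>2 = \<epsilon> + \<eta> \<and> \<epsilon>1 \<ge> 0 \<and> \<epsilon>2 \<ge> 0}.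
        \<Union>(x1s, y1s)\<in>eps_subdifferential_pairs \<epsilon>1 \<phi> (x, y).
          (\<lambda>x2s. \<lambda>u. x1s u + x2s u) ` eps_coderivative \<epsilon>2 F (x, y) y1s)})"
proof -
  obtain w0 l0 where epi0: "(w0, l0) \<in> interior (epi \<phi>)"
    and gph0: "(w0, l0) \<in> interior (gph F \<times> {0..})"
    using assms(5) by auto
  have "w0 \<in> interior (gph F)" using gph0 by (simp add: interior_Times)
  note w0 = epi0 this
  obtain m where m: "conjugate (optimal_value \<phi> F) x0s = ereal m"
    using assms(9) unfolding assms(3) by (cases "conjugate (optimal_value \<phi> F) x0s") auto
  define A where "A E = {x. \<exists>y\<in>F x. \<exists>r. \<phi> (x, y) = ereal r \<and> m \<le> x0s x - r + E}" for E
  have "{x. \<exists>y\<in>F x. x0s \<in>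
      (\<Union>(\<epsilon>1, \<epsilon>2)\<in>{(\<epsilon>1, \<epsilon>2). \<epsilon>1 + \<epsilon>2 = E \<and> \<epsilon>1 \<ge> 0 \<and> \<epsilon>2 \<ge> 0}.
        \<Union>(x1s, y1s)\<in>eps_subdifferential_pairs \<epsilon>1 \<phi> (x, y).
          (\<lambda>x2s. \<lambda>u. x1s u + x2s u) ` eps_coderivative \<epsilon>2 F (x, y) y1s)} = A E" for E
  proof -
    have "x0s \<in> (\<Union>(\<epsilon>1, \<epsilon>2)\<in>{(\<epsilon>1, \<epsilon>2). \<epsilon>1 + \<epsilon>2 = E \<and> \<epsilon>1 \<ge> 0 \<and> \<epsilon>2 \<ge> 0}.
        \<Union>(x1s, y1s)\<in>eps_subdifferential_pairs \<epsilon>1 \<phi> (x, y).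
          (\<lambda>x2s. \<lambda>u. x1s u + x2s u) ` eps_coderivative \<epsilon>2 F (x, y) y1s) \<longleftrightarrow>
      (\<exists>e1 e2 x1s y1s x2s. e1 + e2 = E \<and> e1 \<ge> 0 \<and> e2 \<ge> 0 \<and>
        (x1s, y1s) \<in> eps_subdifferential_pairs e1 \<phi> (x, y) \<and>
        x2s \<in> eps_coderivative e2 F (x, y) y1s \<and> x0s = (\<lambda>u. x1s u + x2s u))" for x y
      by blast
    then show ?thesis
      unfolding A_def using eps_chain_rule_iff[OF assms(1,2) w0 assms(8)] m by simp
  qed
  moreover have "eps_subdifferential_dual \<epsilon> (conjugate (optimal_value \<phi> F)) x0s =
    (\<Inter>\<eta>\<in>{0<..}. closure (A (\<epsilon> + \<eta>)))"
  proof (intro equalityI subsetI INT_I)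
    fix x and \<eta> :: real
    assume x: "x \<in> eps_subdifferential_dual \<epsilon> (conjugate (optimal_value \<phi> F)) x0s" and "\<eta> \<in> {0<..}"
    then have eta: "\<eta> > 0" by simp
    have "A (\<epsilon> + \<eta>) \<inter> U \<noteq> {}" if U: "open U" "x \<in> U" for U
    proof -
      obtain u v l where uv: "u \<in> U" "v \<in> F u" "\<phi> (u, v) \<le> ereal l" "l < x0s u - m + \<epsilon> + \<eta>"
        using eps_subdifferential_dual_approx[OF assms(1,2) w0 assms(8) m x U eta] by blast
      have "- \<infinity> < optimal_value \<phi> F u" using assms(3,4) by (auto simp: proper_on_def)
      also have "\<dots> \<le> \<phi> (u, v)" unfolding optimal_value_def by (rule INF_lower[OF uv(2)])
      finally obtain r where "\<phi> (u, v) = ereal r" using uv(3) by (cases "\<phi> (u, v)") auto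
      then have "u \<in> A (\<epsilon> + \<eta>)" using uv unfolding A_def by force
      then show ?thesis using uv(1) by blast
    qed
    then show "x \<in> closure (A (\<epsilon> + \<eta>))" unfolding closure_iff_nhds_not_empty by blast
  next
    fix x assume x: "x \<in> (\<Inter>\<eta>\<in>{0<..}. closure (A (\<epsilon> + \<eta>)))"
    have "ereal (xs x - x0s x) \<le> conjugate (optimal_value \<phi> F) xs - ereal m + ereal \<epsilon>"
      if xs: "xs \<in> dual_space" for xs
    proof (cases "conjugate (optimal_value \<phi> F) xs")
      case (real k)
      have "xs x - x0s x \<le> k - m + \<epsilon> + \<eta>" if "\<eta> > 0" for \<eta>
      proof -
        let ?B = "{x. xs x - x0s x \<le> k - m + \<epsilon> + \<eta>}"
        have "A (\<epsilon> + \<eta>) \<subseteq> ?B"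
          using real conjugate_optimal_value_le_iff[of \<phi> F xs k] unfolding A_def by fastforce
        moreover have "closed ?B"
          using xs assms(8) unfolding dual_space_def
          by (intro closed_Collect_le continuous_intros) auto
        ultimately have "closure (A (\<epsilon> + \<eta>)) \<subseteq> ?B" by (rule closure_minimal)
        then show ?thesis using x that by auto
      qed
      then have "xs x - x0s x \<le> k - m + \<epsilon>" by (rule field_le_epsilon)
      then show ?thesis using real by simp
    next
      case MInf
      then show ?thesis using assms(3,6) xs by (auto simp: proper_on_def)
    qed simp
    then show "x \<in> eps_subdifferential_dual \<epsilon> (conjugate (optimal_value \<phi> F)) x0s"
      using m by (simp add: eps_subdifferential_dual_def)
  qed
  ultimately show ?thesis unfolding assms(3) by simp
qed

end
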